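(* Let $X$ be a simplicial set. If $X$ is non-singular, then the simplicial mapping set $X^{\Delta[1]}$ is non-singular.
   Context: A simplicial set $X$ is non-singular if for each $n\ge0$ and each non-degenerate simplex $x\in X_n$ the representing map $\bar x\colon\Delta[n]\to X$ (corresponding to $x$ under the Yoneda lemma) is degreewise injective. The simplicial mapping set $X^{\Delta[1]}$ is the simplicial set whose $n$-simplices are the simplicial maps $\Delta[n]\times\Delta[1]\to X$, where an operator (order-preserving function) $\alpha\colon[m]\to[n]$ acts by precomposition with $\alpha\times1\colon\Delta[m]\times\Delta[1]\to\Delta[n]\times\Delta[1]$. *)

theory Defs
  imports "HOL-Library.FuncSet"
begin

text \<open>
  Operators \<open>[m] \<rightarrow> [n]\<close>, where \<open>[n] = {0, \<dots>, n}\<close>. They are taken extensional outside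
  \<open>[m]\<close>, so that equality of HOL functions is equality of operators. Composition is
  \<^const>\<open>compose\<close>; for instance \<open>compose {..l} \<beta> \<alpha>\<close> is \<open>\<beta> \<circ> \<alpha>\<close> for \<open>\<alpha> : [l] \<rightarrow> [m]\<close>.
\<close>

definition operators :: "nat \<Rightarrow> nat \<Rightarrow> (nat \<Rightarrow> nat) set" where
  "operators m n = {\<alpha> \<in> {..m} \<rightarrow>\<^sub>E {..n}. mono_on {..m} \<alpha>}"

definition id_operator :: "nat \<Rightarrow> nat \<Rightarrow> nat" where
  "id_operator n = (\<lambda>i\<in>{..n}. i)"

text \<open>
  \<open>act X m n \<alpha> x\<close> is the simplex \<open>x\<alpha> \<in> X\<^sub>m\<close> for \<open>x \<in> X\<^sub>n\<close> and \<open>\<alpha> : [m] \<rightarrow> [n]\<close>. All degrees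
  share one carrier type and need not be disjoint, which is why the degrees are arguments.
\<close>

record 'a sset =
  simplices :: "nat \<Rightarrow> 'a set"
  act :: "nat \<Rightarrow> nat \<Rightarrow> (nat \<Rightarrow> nat) \<Rightarrow> 'a \<Rightarrow> 'a"

definition simplicial_set :: "'a sset \<Rightarrow> bool" where
  "simplicial_set X \<longleftrightarrow>
     (\<forall>m n. \<forall>\<alpha>\<in>operators m n. \<forall>x\<in>simplices X n. act X m n \<alpha> x \<in> simplices X m) \<and>
     (\<forall>n. \<forall>x\<in>simplices X n. act X n n (id_operator n) x = x) \<and>
     (\<forall>l m n. \<forall>\<alpha>\<in>operators l m. \<forall>\<beta>\<in>operators m n. \<forall>x\<in>simplices X n.
        act X l n (compose {..l} \<beta> \<alpha>) x = act X l m \<alpha> (act X m n \<beta> x))"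

text \<open>
  Simplicial maps are families of functions, one for each degree, again extensional, so that
  distinct elements of \<open>simplicial_maps X Y\<close> are distinct simplicial maps.
\<close>

definition simplicial_maps :: "'a sset \<Rightarrow> 'b sset \<Rightarrow> (nat \<Rightarrow> 'a \<Rightarrow> 'b) set" where
  "simplicial_maps X Y =
     {f. (\<forall>n. f n \<in> simplices X n \<rightarrow>\<^sub>E simplices Y n) \<and>
         (\<forall>m n. \<forall>\<alpha>\<in>operators m n. \<forall>x\<in>simplices X n.
            f m (act X m n \<alpha> x) = act Y m n \<alpha> (f n x))}"

definition degreewise_injective :: "'a sset \<Rightarrow> (nat \<Rightarrow> 'a \<Rightarrow> 'b) \<Rightarrow> bool" where
  "degreewise_injective X f \<longleftrightarrow> (\<forall>n. inj_on (f n) (simplices X n))"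

definition std_simplex :: "nat \<Rightarrow> (nat \<Rightarrow> nat) sset" where
  "std_simplex n =
     \<lparr>simplices = (\<lambda>k. operators k n),
      act = (\<lambda>l k \<alpha> \<beta>. compose {..l} \<beta> \<alpha>)\<rparr>"

definition prod_sset :: "'a sset \<Rightarrow> 'b sset \<Rightarrow> ('a \<times> 'b) sset" where
  "prod_sset X Y =
     \<lparr>simplices = (\<lambda>n. simplices X n \<times> simplices Y n),
      act = (\<lambda>m n \<alpha> (x, y). (act X m n \<alpha> x, act Y m n \<alpha> y))\<rparr>"

definition representing_map :: "'a sset \<Rightarrow> nat \<Rightarrow> 'a \<Rightarrow> nat \<Rightarrow> (nat \<Rightarrow> nat) \<Rightarrow> 'a" where
  "representing_map X n x = (\<lambda>k. \<lambda>\<alpha>\<in>simplices (std_simplex n) k. act X k n \<alpha> x)"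

definition degenerate :: "'a sset \<Rightarrow> nat \<Rightarrow> 'a \<Rightarrow> bool" where
  "degenerate X n x \<longleftrightarrow>
     (\<exists>m<n. \<exists>\<sigma>\<in>operators n m. \<exists>y\<in>simplices X m. \<sigma> ` {..n} = {..m} \<and> x = act X n m \<sigma> y)"

definition non_singular :: "'a sset \<Rightarrow> bool" where
  "non_singular X \<longleftrightarrow> simplicial_set X \<and>
     (\<forall>n. \<forall>x\<in>simplices X n. \<not> degenerate X n x \<longrightarrow>
        degreewise_injective (std_simplex n) (representing_map X n x))"

text \<open>
  The mapping set \<open>X\<^sup>K\<close>. An operator \<open>\<alpha> : [m] \<rightarrow> [n]\<close> sends \<open>f : \<Delta>[n] \<times> K \<rightarrow> X\<close> to the
  composite of \<open>f\<close> with \<open>\<alpha> \<times> 1\<close>, which maps \<open>(\<beta>, y)\<close> to \<open>(\<alpha> \<circ> \<beta>, y)\<close>.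
\<close>

definition mapping_sset :: "'a sset \<Rightarrow> 'k sset \<Rightarrow> (nat \<Rightarrow> (nat \<Rightarrow> nat) \<times> 'k \<Rightarrow> 'a) sset" where
  "mapping_sset X K =
     \<lparr>simplices = (\<lambda>n. simplicial_maps (prod_sset (std_simplex n) K) X),
      act = (\<lambda>m n \<alpha> f. \<lambda>k. \<lambda>(\<beta>, y)\<in>simplices (prod_sset (std_simplex m) K) k.
               f k (compose {..k} \<alpha> \<beta>, y))\<rparr>"

lemma operator_comp:
  assumes "\<alpha> \<in> operators l m" "\<beta> \<in> operators m n"
  shows "compose {..l} \<beta> \<alpha> \<in> operators l n"
proof -
  have "\<alpha> i \<in> {..m}" if "i \<in> {..l}" for i
    using assms(1) that by (auto simp: operators_def)
  then show ?thesis
    using assms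
    by (auto simp: operators_def compose_def mono_on_def PiE_iff)
qed

lemma id_operator_in: "id_operator n \<in> operators n n"
  by (auto simp: operators_def id_operator_def mono_on_def)

lemma compose_id_left: "\<alpha> \<in> operators m n \<Longrightarrow> compose {..m} (id_operator n) \<alpha> = \<alpha>"
  by (auto simp: operators_def id_operator_def compose_def PiE_iff extensional_def fun_eq_iff
      restrict_def)

lemma compose_id_right: "\<alpha> \<in> operators m n \<Longrightarrow> compose {..m} \<alpha> (id_operator m) = \<alpha>"
  by (auto simp: operators_def id_operator_def compose_def PiE_iff extensional_def fun_eq_iff
      restrict_def)

lemma operator_assoc:
  assumes "\<alpha> \<in> operators k l"
  shows "compose {..k} (compose {..l} \<gamma> \<beta>) \<alpha> = compose {..k} \<gamma> (compose {..k} \<beta> \<alpha>)"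
proof -
  have "\<alpha> i \<in> {..l}" if "i \<in> {..k}" for i
    using assms that by (auto simp: operators_def)
  then show ?thesis by (auto simp: compose_def fun_eq_iff restrict_def)
qed

lemma simplicial_set_std_simplex: "simplicial_set (std_simplex n)"
  unfolding simplicial_set_def std_simplex_def
  by (simp add: operator_comp compose_id_right operator_assoc)

lemma simplicial_set_prod:
  assumes "simplicial_set X" "simplicial_set Y"
  shows "simplicial_set (prod_sset X Y)"
  using assms unfolding simplicial_set_def prod_sset_def by simp

lemma simplicial_set_mapping:
  assumes X: "simplicial_set X" and K: "simplicial_set K"
  shows "simplicial_set (mapping_sset X K)"
proof -
  let ?M = "mapping_sset X K"
  have K1: "act K p q \<delta> y \<in> simplices K p"
    if "\<delta> \<in> operators p q" "y \<in> simplices K q" for p q \<delta> y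
    using K that unfolding simplicial_set_def by blast
  have 1: "act ?M m n \<alpha> f \<in> simplices ?M m"
    if a: "\<alpha> \<in> operators m n" and f: "f \<in> simplices ?M n" for m n \<alpha> f
    using f
    by (auto simp: mapping_sset_def simplicial_maps_def prod_sset_def std_simplex_def K1
        operator_comp[OF _ a] operator_comp operator_assoc[symmetric] PiE_iff)
  have 2: "act ?M n n (id_operator n) f = f" if f: "f \<in> simplices ?M n" for n f
    using f
    by (fastforce simp: mapping_sset_def simplicial_maps_def prod_sset_def std_simplex_def
        compose_id_left PiE_iff extensional_def fun_eq_iff restrict_def)
  have 3: "act ?M l n (compose {..l} \<beta> \<alpha>) f = act ?M l m \<alpha> (act ?M m n \<beta> f)"
    if a: "\<alpha> \<in> operators l m" for l m n \<alpha> \<beta> f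
    by (auto simp: mapping_sset_def prod_sset_def std_simplex_def operator_comp[OF _ a]
        operator_assoc fun_eq_iff restrict_def)
  show ?thesis unfolding simplicial_set_def using 1 2 3 by blast
qed

text \<open>The Yoneda lemma: \<open>representing_map X n x\<close> is the map corresponding to \<open>x\<close>.\<close>

lemma representing_map_unique:
  assumes X: "simplicial_set X" and x: "x \<in> simplices X n"
  shows "f \<in> simplicial_maps (std_simplex n) X \<and> f n (id_operator n) = x
           \<longleftrightarrow> f = representing_map X n x"
proof
  assume f: "f \<in> simplicial_maps (std_simplex n) X \<and> f n (id_operator n) = x"
  have "f k \<alpha> = representing_map X n x k \<alpha>" for k \<alpha>
  proof (cases "\<alpha> \<in> operators k n")
    case True
    have "f k (act (std_simplex n) k n \<alpha> (id_operator n)) = act X k n \<alpha> (f n (id_operator n))"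
      using f True id_operator_in[of n] by (simp add: simplicial_maps_def std_simplex_def)
    then show ?thesis
      using f True by (simp add: representing_map_def std_simplex_def compose_id_left)
  next
    case False
    moreover have "f k \<in> extensional (operators k n)"
      using f by (auto simp: simplicial_maps_def std_simplex_def PiE_iff)
    ultimately show ?thesis
      by (simp add: representing_map_def std_simplex_def extensional_def)
  qed
  then show "f = representing_map X n x" by blast
next
  assume "f = representing_map X n x"
  then show "f \<in> simplicial_maps (std_simplex n) X \<and> f n (id_operator n) = x"
    using X x unfolding simplicial_set_def
    by (simp add: representing_map_def simplicial_maps_def std_simplex_def id_operator_in
        operator_comp)
qed

end

theory Submission
  imports Defs
begin

text \<open>
  A simplex is embedded by its representing map as soon as its vertices are distinct. So it is
  to be shown that a simplex \<open>f : \<Delta>[n] \<times> \<Delta>[1] \<rightarrow> X\<close> of the mapping set with two equal vertices is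
  degenerate. Equality of the vertices \<open>a < b\<close> of \<open>f\<close> gives \<open>f(a, \<epsilon>) = f(b, \<epsilon>)\<close> for both vertices
  \<open>\<epsilon>\<close> of \<open>\<Delta>[1]\<close>.

  Non-singularity of \<open>X\<close> enters as a rigidity principle (\<open>act_eq_if_vertices_eq\<close>): every simplex of
  \<open>X\<close> is a degeneracy of an embedded one, hence two simplices obtained from one simplex of \<open>X\<close> by
  operators are equal if they have the same vertices. In the same way, vertices of a simplex that lie
  between two equal vertices are equal to them (\<open>vertex_eq_between\<close>). Applied to the simplices
  \<open>f(-, \<epsilon>)\<close>, the latter gives \<open>f(a, \<epsilon>) = f(a + 1, \<epsilon>)\<close>.

  Let \<open>e : [n] \<rightarrow> [n]\<close> send \<open>a + 1\<close> to \<open>a\<close> and fix everything else. It factors through \<open>[n - 1]\<close>, so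
  \<open>f\<close> is degenerate once \<open>f \<circ> (e \<times> 1) = f\<close>. For a simplex \<open>(\<beta>, y)\<close> of the prism, \<open>f(\<beta>, y)\<close> and
  \<open>f(e\<beta>, y)\<close> have the same vertices, but \<open>(\<beta>, y)\<close> and \<open>(e\<beta>, y)\<close> need not lie in a common simplex of
  the prism: \<open>(a + 1, 0)\<close> and \<open>(a, 1)\<close> are incomparable. The remedy is to collapse first the part over
  \<open>0\<close> and then the part over \<open>1\<close>. Each of these steps takes place inside one of the maximal simplices
  \<open>(0, 0) < \<dots> < (m, 0) < (m, 1) < \<dots> < (n, 1)\<close>, where rigidity applies.
\<close>

section \<open>Operators\<close>

definition vertex :: "nat \<Rightarrow> nat \<Rightarrow> nat" where
  "vertex a = (\<lambda>i\<in>{..0}. a)"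

lemma operatorsI:
  assumes "\<And>i. i \<le> m \<Longrightarrow> h i \<le> n" "\<And>i j. i \<le> j \<Longrightarrow> j \<le> m \<Longrightarrow> h i \<le> h j"
  shows "(\<lambda>i\<in>{..m}. h i) \<in> operators m n"
  using assms by (auto simp: operators_def mono_on_def)

lemma operators_le: "\<alpha> \<in> operators m n \<Longrightarrow> i \<le> m \<Longrightarrow> \<alpha> i \<le> n"
  by (auto simp: operators_def)

lemma operators_mono: "\<alpha> \<in> operators m n \<Longrightarrow> i \<le> j \<Longrightarrow> j \<le> m \<Longrightarrow> \<alpha> i \<le> \<alpha> j"
  by (auto simp: operators_def mono_on_def)

lemma operators_eqI:
  assumes "\<alpha> \<in> operators m n" "\<beta> \<in> operators m n'" "\<And>i. i \<le> m \<Longrightarrow> \<alpha> i = \<beta> i"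
  shows "\<alpha> = \<beta>"
proof -
  have "\<alpha> \<in> extensional {..m}" "\<beta> \<in> extensional {..m}"
    using assms by (auto simp: operators_def PiE_iff)
  then show ?thesis
    using assms(3) by (intro extensionalityI) auto
qed

lemma vertex_in: "a \<le> n \<Longrightarrow> vertex a \<in> operators 0 n"
  unfolding vertex_def by (intro operatorsI) auto

lemma compose_vertex: "compose {..0} \<alpha> (vertex a) = vertex (\<alpha> a)"
  by (auto simp: vertex_def compose_def)

lemma compose_surj:
  assumes "\<sigma> ` {..n} = {..m}" "\<tau> ` {..m} = {..l}"
  shows "compose {..n} \<tau> \<sigma> ` {..n} = {..l}"
  using surj_compose[OF assms] .

section \<open>Vertices of simplices\<close>

lemma act_in:
  "simplicial_set X \<Longrightarrow> \<alpha> \<in> operators m n \<Longrightarrow> x \<in> simplices X n \<Longrightarrow> act X m n \<alpha> x \<in> simplices X m"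
  unfolding simplicial_set_def by blast

lemma act_comp:
  "simplicial_set X \<Longrightarrow> \<alpha> \<in> operators l m \<Longrightarrow> \<beta> \<in> operators m n \<Longrightarrow> x \<in> simplices X n \<Longrightarrow>
    act X l n (compose {..l} \<beta> \<alpha>) x = act X l m \<alpha> (act X m n \<beta> x)"
  unfolding simplicial_set_def by blast

lemma act_vertex:
  assumes "simplicial_set X" "\<alpha> \<in> operators m n" "x \<in> simplices X n" "i \<le> m"
  shows "act X 0 m (vertex i) (act X m n \<alpha> x) = act X 0 n (vertex (\<alpha> i)) x"
  using act_comp[OF assms(1) vertex_in[OF assms(4)] assms(2,3)] by (simp only: compose_vertex)

lemma degreewise_injective_if_vertices_distinct:
  assumes X: "simplicial_set X" and x: "x \<in> simplices X n"
    and inj: "inj_on (\<lambda>a. act X 0 n (vertex a) x) {..n}"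
  shows "degreewise_injective (std_simplex n) (representing_map X n x)"
  unfolding degreewise_injective_def
proof (intro allI inj_onI)
  fix k \<alpha> \<beta>
  assume "\<alpha> \<in> simplices (std_simplex n) k" "\<beta> \<in> simplices (std_simplex n) k"
    and eq: "representing_map X n x k \<alpha> = representing_map X n x k \<beta>"
  then have ab: "\<alpha> \<in> operators k n" "\<beta> \<in> operators k n"
    by (auto simp: std_simplex_def)
  then have *: "act X k n \<alpha> x = act X k n \<beta> x"
    using eq by (simp add: representing_map_def std_simplex_def)
  show "\<alpha> = \<beta>"
  proof (rule operators_eqI[OF ab])
    fix i assume i: "i \<le> k"
    have "act X 0 n (vertex (\<alpha> i)) x = act X 0 n (vertex (\<beta> i)) x"
      using act_vertex[OF X ab(1) x i] act_vertex[OF X ab(2) x i] * by simp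
    then show "\<alpha> i = \<beta> i"
      using inj ab i by (auto dest!: inj_onD simp: operators_le)
  qed
qed

lemma vertices_distinct_if_degreewise_injective:
  assumes "degreewise_injective (std_simplex n) (representing_map X n x)"
  shows "inj_on (\<lambda>a. act X 0 n (vertex a) x) {..n}"
proof (rule inj_onI)
  fix a b
  assume a: "a \<in> {..n}" and b: "b \<in> {..n}"
    and eq: "act X 0 n (vertex a) x = act X 0 n (vertex b) x"
  have "inj_on (representing_map X n x 0) (operators 0 n)"
    using assms by (simp add: degreewise_injective_def std_simplex_def)
  moreover have "vertex a \<in> operators 0 n" "vertex b \<in> operators 0 n"
    using a b by (auto intro: vertex_in)
  moreover from this have "representing_map X n x 0 (vertex a) = representing_map X n x 0 (vertex b)"
    using eq by (simp add: representing_map_def std_simplex_def)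
  ultimately have "vertex a 0 = vertex b 0"
    by (auto dest: inj_onD)
  then show "a = b"
    by (simp add: vertex_def)
qed

section \<open>Rigidity of simplices in non-singular simplicial sets\<close>

text \<open>The existence half of the Eilenberg--Zilber lemma, by descent on the degree.\<close>

lemma nondegenerate_factorization:
  assumes X: "simplicial_set X" and "x \<in> simplices X n"
  shows "\<exists>m \<sigma> y. \<sigma> \<in> operators n m \<and> \<sigma> ` {..n} = {..m} \<and> y \<in> simplices X m \<and>
    \<not> degenerate X m y \<and> x = act X n m \<sigma> y"
  using assms(2)
proof (induction n arbitrary: x rule: less_induct)
  case (less n)
  show ?case
  proof (cases "degenerate X n x")
    case True
    then obtain m \<sigma> y where m: "m < n" and s: "\<sigma> \<in> operators n m" "\<sigma> ` {..n} = {..m}"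
      and y: "y \<in> simplices X m" "x = act X n m \<sigma> y"
      unfolding degenerate_def by blast
    from less.IH[OF m y(1)] obtain l \<tau> z where
      t: "\<tau> \<in> operators m l" "\<tau> ` {..m} = {..l}" and z: "z \<in> simplices X l"
      "\<not> degenerate X l z" "y = act X m l \<tau> z"
      by (elim exE conjE)
    have "x = act X n l (compose {..n} \<tau> \<sigma>) z"
      using act_comp[OF X s(1) t(1) z(1)] y z by simp
    then show ?thesis
      using operator_comp[OF s(1) t(1)] compose_surj[OF s(2) t(2)] z(1,2)
      by (intro exI[of _ l] exI[of _ "compose {..n} \<tau> \<sigma>"] exI[of _ z]) simp
  next
    case False
    have "id_operator n ` {..n} = {..n}"
      by (simp add: id_operator_def)
    moreover have "x = act X n n (id_operator n) x"
      using X less.prems by (simp add: simplicial_set_def)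
    ultimately show ?thesis
      using False less.prems id_operator_in[of n]
      by - (intro exI[of _ n] exI[of _ "id_operator n"] exI[of _ x] conjI; assumption)
  qed
qed

text \<open>
  In the factorization into a degeneracy \<open>\<sigma>\<close> and a non-degenerate simplex \<open>y\<close>, the vertices of \<open>y\<close>
  are distinct because \<open>y\<close> is embedded. So all coincidences between vertices of \<open>x\<close> come from \<open>\<sigma>\<close>.
\<close>

lemma vertex_classifying_degeneracy:
  assumes "non_singular X" and "x \<in> simplices X n"
  shows "\<exists>m \<sigma> y. \<sigma> \<in> operators n m \<and> y \<in> simplices X m \<and> x = act X n m \<sigma> y \<and>
    (\<forall>a\<le>n. \<forall>b\<le>n. act X 0 n (vertex a) x = act X 0 n (vertex b) x \<longleftrightarrow> \<sigma> a = \<sigma> b)"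
proof -
  have X: "simplicial_set X"
    using assms(1) by (simp add: non_singular_def)
  obtain m \<sigma> y where s: "\<sigma> \<in> operators n m" and y: "y \<in> simplices X m" "\<not> degenerate X m y"
    and x: "x = act X n m \<sigma> y"
    using nondegenerate_factorization[OF X assms(2)] by (elim exE conjE)
  have inj: "inj_on (\<lambda>a. act X 0 m (vertex a) y) {..m}"
    using assms(1) y by (intro vertices_distinct_if_degreewise_injective) (simp add: non_singular_def)
  have "act X 0 n (vertex a) x = act X 0 n (vertex b) x \<longleftrightarrow> \<sigma> a = \<sigma> b"
    if "a \<le> n" "b \<le> n" for a b
  proof -
    have "\<sigma> a \<in> {..m}" "\<sigma> b \<in> {..m}"
      using that operators_le[OF s] by auto
    then show ?thesis
      using inj_on_eq_iff[OF inj] act_vertex[OF X s y(1)] that x by simp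
  qed
  then show ?thesis
    by (intro exI[of _ m] exI[of _ \<sigma>] exI[of _ y] conjI s y(1) x) simp
qed

lemma act_eq_if_vertices_eq:
  assumes ns: "non_singular X" and x: "x \<in> simplices X n"
    and a: "\<alpha> \<in> operators k n" and b: "\<beta> \<in> operators k n"
    and eq: "\<And>i. i \<le> k \<Longrightarrow> act X 0 n (vertex (\<alpha> i)) x = act X 0 n (vertex (\<beta> i)) x"
  shows "act X k n \<alpha> x = act X k n \<beta> x"
proof -
  have X: "simplicial_set X"
    using ns by (simp add: non_singular_def)
  obtain m \<sigma> y where s: "\<sigma> \<in> operators n m" and y: "y \<in> simplices X m" and x': "x = act X n m \<sigma> y"
    and cl: "\<forall>a\<le>n. \<forall>b\<le>n.
      act X 0 n (vertex a) x = act X 0 n (vertex b) x \<longleftrightarrow> \<sigma> a = \<sigma> b"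
    using vertex_classifying_degeneracy[OF ns x] by (elim exE conjE)
  have "compose {..k} \<sigma> \<alpha> = compose {..k} \<sigma> \<beta>"
  proof (rule operators_eqI[OF operator_comp[OF a s] operator_comp[OF b s]])
    fix i assume "i \<le> k"
    then show "compose {..k} \<sigma> \<alpha> i = compose {..k} \<sigma> \<beta> i"
      using eq cl a b by (auto simp: compose_def operators_le)
  qed
  then show ?thesis
    using act_comp[OF X a s y] act_comp[OF X b s y] x' by simp
qed

lemma vertex_eq_between:
  assumes ns: "non_singular X" and x: "x \<in> simplices X n" and "a \<le> c" "c \<le> b" "b \<le> n"
    and "act X 0 n (vertex a) x = act X 0 n (vertex b) x"
  shows "act X 0 n (vertex a) x = act X 0 n (vertex c) x"
proof -
  obtain m \<sigma> y where s: "\<sigma> \<in> operators n m" and y: "y \<in> simplices X m" and x': "x = act X n m \<sigma> y"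
    and cl: "\<forall>a\<le>n. \<forall>b\<le>n.
      act X 0 n (vertex a) x = act X 0 n (vertex b) x \<longleftrightarrow> \<sigma> a = \<sigma> b"
    using vertex_classifying_degeneracy[OF ns x] by (elim exE conjE)
  have "\<sigma> a \<le> \<sigma> c" "\<sigma> c \<le> \<sigma> b"
    using assms(3-5) by (auto intro!: operators_mono[OF s])
  moreover have "\<sigma> a = \<sigma> b"
    using cl assms(3-6) by auto
  ultimately show ?thesis
    using cl assms(3-5) by auto
qed

section \<open>Simplices of the prism\<close>

abbreviation prism :: "nat \<Rightarrow> ((nat \<Rightarrow> nat) \<times> (nat \<Rightarrow> nat)) sset" where
  "prism n \<equiv> prod_sset (std_simplex n) (std_simplex 1)"

lemma prism_map_in:
  assumes "f \<in> simplicial_maps (prism n) X" "\<beta> \<in> operators k n" "y \<in> operators k 1"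
  shows "f k (\<beta>, y) \<in> simplices X k"
proof -
  have "f k \<in> simplices (prism n) k \<rightarrow>\<^sub>E simplices X k"
    using assms(1) by (simp add: simplicial_maps_def)
  then show ?thesis
    using assms(2,3) by (auto simp: prod_sset_def std_simplex_def)
qed

lemma prism_map_natural:
  assumes "f \<in> simplicial_maps (prism n) X" "\<beta> \<in> operators k n" "y \<in> operators k 1"
    "\<alpha> \<in> operators l k"
  shows "act X l k \<alpha> (f k (\<beta>, y)) = f l (compose {..l} \<beta> \<alpha>, compose {..l} y \<alpha>)"
  using assms by (auto simp: simplicial_maps_def prod_sset_def std_simplex_def)

lemma prism_map_vertex:
  assumes "f \<in> simplicial_maps (prism n) X" "\<beta> \<in> operators k n" "y \<in> operators k 1" "i \<le> k"
  shows "act X 0 k (vertex i) (f k (\<beta>, y)) = f 0 (vertex (\<beta> i), vertex (y i))"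
  using prism_map_natural[OF assms(1-3) vertex_in[OF assms(4)]] by (simp only: compose_vertex)

text \<open>
  The hypotheses on \<open>m\<close> say that \<open>(\<beta>, y)\<close> and \<open>(\<gamma>, y)\<close> both lie in the maximal simplex that changes
  from \<open>0\<close> to \<open>1\<close> over the vertex \<open>m\<close>. Rigidity applies to the image of that simplex.
\<close>

lemma prism_map_eq_in_maximal_simplex:
  assumes ns: "non_singular X" and f: "f \<in> simplicial_maps (prism n) X"
    and b: "\<beta> \<in> operators k n" and g: "\<gamma> \<in> operators k n" and y: "y \<in> operators k 1"
    and m: "m \<le> n"
    and low: "\<And>i. i \<le> k \<Longrightarrow> y i = 0 \<Longrightarrow> \<beta> i \<le> m \<and> \<gamma> i \<le> m"
    and high: "\<And>i. i \<le> k \<Longrightarrow> y i = 1 \<Longrightarrow> m \<le> \<beta> i \<and> m \<le> \<gamma> i"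
    and eq: "\<And>i. i \<le> k \<Longrightarrow> f 0 (vertex (\<beta> i), vertex (y i)) = f 0 (vertex (\<gamma> i), vertex (y i))"
  shows "f k (\<beta>, y) = f k (\<gamma>, y)"
proof -
  define p where "p = (\<lambda>i\<in>{..Suc n}. if i \<le> m then i else i - 1)"
  define q where "q = (\<lambda>i\<in>{..Suc n}. if i \<le> m then 0 else 1 :: nat)"
  have p: "p \<in> operators (Suc n) n" and q: "q \<in> operators (Suc n) 1"
    unfolding p_def q_def using m by (auto intro!: operatorsI)
  \<comment> \<open>Along a maximal simplex, a vertex is determined by the sum of its coordinates.\<close>
  define lift where "lift \<alpha> = (\<lambda>i\<in>{..k}. \<alpha> i + y i)" for \<alpha> :: "nat \<Rightarrow> nat"
  have y01: "y i = 0 \<or> y i = 1" if "i \<le> k" for i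
    using operators_le[OF y that] by auto
  have lift: "lift \<alpha> \<in> operators k (Suc n)"
    and p_lift: "compose {..k} p (lift \<alpha>) = \<alpha>" and q_lift: "compose {..k} q (lift \<alpha>) = y"
    if a: "\<alpha> \<in> operators k n" and al: "\<And>i. i \<le> k \<Longrightarrow> y i = 0 \<Longrightarrow> \<alpha> i \<le> m"
      and ah: "\<And>i. i \<le> k \<Longrightarrow> y i = 1 \<Longrightarrow> m \<le> \<alpha> i" for \<alpha>
  proof -
    show l: "lift \<alpha> \<in> operators k (Suc n)"
      unfolding lift_def
    proof (rule operatorsI)
      show "\<alpha> i + y i \<le> Suc n" if "i \<le> k" for i
        using operators_le[OF a that] operators_le[OF y that] by simp
      show "\<alpha> i + y i \<le> \<alpha> j + y j" if "i \<le> j" "j \<le> k" for i j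
        using operators_mono[OF a that] operators_mono[OF y that] by simp
    qed
    have le: "\<alpha> i + y i \<le> Suc n" if "i \<le> k" for i
      using operators_le[OF a that] operators_le[OF y that] by simp
    show "compose {..k} p (lift \<alpha>) = \<alpha>"
    proof (rule operators_eqI[OF operator_comp[OF l p] a])
      fix i assume i: "i \<le> k"
      show "compose {..k} p (lift \<alpha>) i = \<alpha> i"
        using y01[OF i] al[OF i] ah[OF i] le[OF i] i by (auto simp: compose_def lift_def p_def)
    qed
    show "compose {..k} q (lift \<alpha>) = y"
    proof (rule operators_eqI[OF operator_comp[OF l q] y])
      fix i assume i: "i \<le> k"
      show "compose {..k} q (lift \<alpha>) i = y i"
        using y01[OF i] al[OF i] ah[OF i] le[OF i] i by (auto simp: compose_def lift_def q_def)
    qed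
  qed
  note b_low_high = b low[THEN conjunct1] high[THEN conjunct1]
  note g_low_high = g low[THEN conjunct2] high[THEN conjunct2]
  note lb = lift[OF b_low_high] p_lift[OF b_low_high] q_lift[OF b_low_high]
  note lg = lift[OF g_low_high] p_lift[OF g_low_high] q_lift[OF g_low_high]
  let ?x = "f (Suc n) (p, q)"
  have X: "simplicial_set X"
    using ns by (simp add: non_singular_def)
  have x: "?x \<in> simplices X (Suc n)"
    by (rule prism_map_in[OF f p q])
  have fb: "act X k (Suc n) (lift \<beta>) ?x = f k (\<beta>, y)"
    using prism_map_natural[OF f p q lb(1)] lb by simp
  have fg: "act X k (Suc n) (lift \<gamma>) ?x = f k (\<gamma>, y)"
    using prism_map_natural[OF f p q lg(1)] lg by simp
  have "act X k (Suc n) (lift \<beta>) ?x = act X k (Suc n) (lift \<gamma>) ?x"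
  proof (rule act_eq_if_vertices_eq[OF ns x lb(1) lg(1)])
    fix i assume i: "i \<le> k"
    have "act X 0 (Suc n) (vertex (lift \<beta> i)) ?x = f 0 (vertex (\<beta> i), vertex (y i))"
      using act_vertex[OF X lb(1) x i] fb prism_map_vertex[OF f b y i] by simp
    moreover have "act X 0 (Suc n) (vertex (lift \<gamma> i)) ?x = f 0 (vertex (\<gamma> i), vertex (y i))"
      using act_vertex[OF X lg(1) x i] fg prism_map_vertex[OF f g y i] by simp
    ultimately show "act X 0 (Suc n) (vertex (lift \<beta> i)) ?x = act X 0 (Suc n) (vertex (lift \<gamma> i)) ?x"
      using eq[OF i] by simp
  qed
  then show ?thesis
    using fb fg by simp
qed

text \<open>
  Since \<open>y\<close> is monotone, the part of a simplex over \<open>0\<close> comes before the part over \<open>1\<close>. Hence any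
  simplex of the prism lies in some maximal one, as in \<open>prism_map_eq_in_maximal_simplex\<close>.
\<close>

lemma prism_simplex_turning_point:
  assumes b: "\<beta> \<in> operators k n" and y: "y \<in> operators k 1"
  obtains m where "m \<le> n" "\<And>i. i \<le> k \<Longrightarrow> y i = 0 \<Longrightarrow> \<beta> i \<le> m"
    "\<And>i. i \<le> k \<Longrightarrow> y i = 1 \<Longrightarrow> m \<le> \<beta> i"
proof -
  \<comment> \<open>The element \<open>0\<close> is inserted because the part over \<open>0\<close> may be empty.\<close>
  define m where "m = Max (insert 0 (\<beta> ` {i. i \<le> k \<and> y i = 0}))"
  have fin: "finite (insert 0 (\<beta> ` {i. i \<le> k \<and> y i = 0}))"
    by simp
  show thesis
  proof
    show "m \<le> n"
      using operators_le[OF b] by (auto simp: m_def)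
    show "\<beta> i \<le> m" if "i \<le> k" "y i = 0" for i
      unfolding m_def using that by (intro Max_ge[OF fin]) auto
    show "m \<le> \<beta> i" if i: "i \<le> k" "y i = 1" for i
    proof -
      have "\<beta> j \<le> \<beta> i" if j: "j \<le> k" "y j = 0" for j
      proof -
        have "j \<le> i"
          using operators_mono[OF y, of i j] i j by (cases "j \<le> i") auto
        then show ?thesis
          using operators_mono[OF b] i by blast
      qed
      then show ?thesis
        by (auto simp: m_def)
    qed
  qed
qed

text \<open>
  The operator \<open>\<gamma>\<close> below follows \<open>e\<beta>\<close> over \<open>0\<close> and \<open>\<beta>\<close> over \<open>1\<close>. It is monotone because
  \<open>e i \<le> i\<close>, and it shares a maximal simplex with either of \<open>\<beta>\<close> and \<open>e\<beta>\<close>.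
\<close>

lemma prism_map_collapse:
  assumes ns: "non_singular X" and f: "f \<in> simplicial_maps (prism n) X"
    and e: "e \<in> operators n n" and dec: "\<And>i. i \<le> n \<Longrightarrow> e i \<le> i"
    and eq: "\<And>i \<epsilon>. i \<le> n \<Longrightarrow> \<epsilon> \<le> 1 \<Longrightarrow>
      f 0 (vertex (e i), vertex \<epsilon>) = f 0 (vertex i, vertex \<epsilon>)"
    and b: "\<beta> \<in> operators k n" and y: "y \<in> operators k 1"
  shows "f k (compose {..k} e \<beta>, y) = f k (\<beta>, y)"
proof -
  define \<gamma> where "\<gamma> = (\<lambda>i\<in>{..k}. if y i = 0 then e (\<beta> i) else \<beta> i)"
  have eb: "compose {..k} e \<beta> \<in> operators k n"
    by (rule operator_comp[OF b e])
  have eb_le: "compose {..k} e \<beta> i \<le> \<beta> i" if "i \<le> k" for i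
    using dec operators_le[OF b] that by (simp add: compose_def)
  have eb_eq: "f 0 (vertex (e (\<beta> i)), vertex (y i)) = f 0 (vertex (\<beta> i), vertex (y i))"
    if "i \<le> k" for i
    using eq operators_le[OF b that] operators_le[OF y that] by blast
  have g: "\<gamma> \<in> operators k n"
    unfolding \<gamma>_def
  proof (rule operatorsI)
    fix i assume "i \<le> k"
    then show "(if y i = 0 then e (\<beta> i) else \<beta> i) \<le> n"
      using operators_le[OF b] operators_le[OF e] by auto
  next
    fix i j assume ij: "i \<le> j" "j \<le> k"
    have "\<beta> i \<le> \<beta> j" "e (\<beta> i) \<le> e (\<beta> j)" "e (\<beta> i) \<le> \<beta> i" "y i \<le> y j"
      using ij operators_mono[OF b ij] operators_le[OF b] dec operators_mono[OF e]
        operators_mono[OF y ij] by auto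
    then show "(if y i = 0 then e (\<beta> i) else \<beta> i) \<le> (if y j = 0 then e (\<beta> j) else \<beta> j)"
      by auto
  qed
  have g_simps: "i \<le> k \<Longrightarrow> y i = 0 \<Longrightarrow> \<gamma> i = compose {..k} e \<beta> i"
    "i \<le> k \<Longrightarrow> y i = 1 \<Longrightarrow> \<gamma> i = \<beta> i" for i
    by (auto simp: \<gamma>_def compose_def)
  have over0: "f k (\<gamma>, y) = f k (\<beta>, y)"
  proof -
    obtain m where m: "m \<le> n" "\<And>i. i \<le> k \<Longrightarrow> y i = 0 \<Longrightarrow> \<beta> i \<le> m"
      "\<And>i. i \<le> k \<Longrightarrow> y i = 1 \<Longrightarrow> m \<le> \<beta> i"
      using prism_simplex_turning_point[OF b y] by blast
    show ?thesis
    proof (rule prism_map_eq_in_maximal_simplex[OF ns f g b y m(1)])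
      show "\<gamma> i \<le> m \<and> \<beta> i \<le> m" if "i \<le> k" "y i = 0" for i
        using g_simps(1)[OF that] eb_le[OF that(1)] m(2)[OF that] by simp
      show "m \<le> \<gamma> i \<and> m \<le> \<beta> i" if "i \<le> k" "y i = 1" for i
        using g_simps(2)[OF that] m(3)[OF that] by simp
      show "f 0 (vertex (\<gamma> i), vertex (y i)) = f 0 (vertex (\<beta> i), vertex (y i))" if "i \<le> k" for i
        using eb_eq[OF that] that by (cases "y i = 0") (simp_all add: \<gamma>_def)
    qed
  qed
  have over1: "f k (compose {..k} e \<beta>, y) = f k (\<gamma>, y)"
  proof -
    obtain m where m: "m \<le> n" "\<And>i. i \<le> k \<Longrightarrow> y i = 0 \<Longrightarrow> compose {..k} e \<beta> i \<le> m"
      "\<And>i. i \<le> k \<Longrightarrow> y i = 1 \<Longrightarrow> m \<le> compose {..k} e \<beta> i"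
      using prism_simplex_turning_point[OF eb y] by blast
    show ?thesis
    proof (rule prism_map_eq_in_maximal_simplex[OF ns f eb g y m(1)])
      show "compose {..k} e \<beta> i \<le> m \<and> \<gamma> i \<le> m" if "i \<le> k" "y i = 0" for i
        using g_simps(1)[OF that] m(2)[OF that] by simp
      show "m \<le> compose {..k} e \<beta> i \<and> m \<le> \<gamma> i" if "i \<le> k" "y i = 1" for i
        using g_simps(2)[OF that] eb_le[OF that(1)] m(3)[OF that] by simp
      show "f 0 (vertex (compose {..k} e \<beta> i), vertex (y i)) = f 0 (vertex (\<gamma> i), vertex (y i))"
        if "i \<le> k" for i
        using eb_eq[OF that] that by (cases "y i = 0") (simp_all add: \<gamma>_def compose_def)
    qed
  qed
  show ?thesis
    using over0 over1 by simp
qed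

section \<open>Simplices of the mapping set\<close>

lemma degenerate_if_adjacent_vertices_eq:
  assumes ns: "non_singular X" and f: "f \<in> simplicial_maps (prism n) X" and a: "a < n"
    and eq: "\<And>\<epsilon>. \<epsilon> \<le> 1 \<Longrightarrow> f 0 (vertex a, vertex \<epsilon>) = f 0 (vertex (Suc a), vertex \<epsilon>)"
  shows "degenerate (mapping_sset X (std_simplex 1)) n f"
proof -
  let ?M = "mapping_sset X (std_simplex 1)"
  have X: "simplicial_set X"
    using ns by (simp add: non_singular_def)
  have M: "simplicial_set ?M"
    using X simplicial_set_std_simplex by (rule simplicial_set_mapping)
  have fM: "f \<in> simplices ?M n"
    using f by (simp add: mapping_sset_def)
  define \<sigma> where "\<sigma> = (\<lambda>i\<in>{..n}. if i \<le> a then i else i - 1)"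
  define \<delta> where "\<delta> = (\<lambda>i\<in>{..n - 1}. if i \<le> a then i else Suc i)"
  define e where "e = compose {..n} \<delta> \<sigma>"
  have s: "\<sigma> \<in> operators n (n - 1)" and d: "\<delta> \<in> operators (n - 1) n"
    unfolding \<sigma>_def \<delta>_def using a by (auto intro!: operatorsI)
  have surj: "\<sigma> ` {..n} = {..n - 1}"
  proof
    show "\<sigma> ` {..n} \<subseteq> {..n - 1}"
      using operators_le[OF s] by auto
    show "{..n - 1} \<subseteq> \<sigma> ` {..n}"
    proof
      fix j assume j: "j \<in> {..n - 1}"
      then have "\<delta> j \<in> {..n}" and "\<sigma> (\<delta> j) = j"
        using a by (auto simp: \<sigma>_def \<delta>_def)
      then show "j \<in> \<sigma> ` {..n}"
        by (metis imageI)
    qed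
  qed
  have e: "e \<in> operators n n"
    unfolding e_def by (rule operator_comp[OF s d])
  have e_val: "e i = (if i = Suc a then a else i)" if "i \<le> n" for i
    using that a by (auto simp: e_def \<sigma>_def \<delta>_def compose_def)
  have "act ?M n n e f = f"
  proof (rule ext, rule ext)
    fix k and z :: "(nat \<Rightarrow> nat) \<times> (nat \<Rightarrow> nat)"
    obtain \<beta> y where z: "z = (\<beta>, y)"
      by (cases z)
    show "act ?M n n e f k z = f k z"
    proof (cases "\<beta> \<in> operators k n \<and> y \<in> operators k 1")
      case True
      then have "f k (compose {..k} e \<beta>, y) = f k (\<beta>, y)"
        using e_val eq by (intro prism_map_collapse[OF ns f e]) auto
      then show ?thesis
        using True z by (simp add: mapping_sset_def prod_sset_def std_simplex_def)
    next
      case False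
      moreover have "f k \<in> extensional (operators k n \<times> operators k 1)"
        using f by (auto simp: simplicial_maps_def prod_sset_def std_simplex_def PiE_iff)
      ultimately show ?thesis
        using z by (auto simp: mapping_sset_def prod_sset_def std_simplex_def extensional_def)
    qed
  qed
  then have f_eq: "f = act ?M n (n - 1) \<sigma> (act ?M (n - 1) n \<delta> f)"
    using act_comp[OF M s d fM] by (simp add: e_def)
  have "n - 1 < n"
    using a by simp
  then show ?thesis
    unfolding degenerate_def
    by (intro exI[of _ "n - 1"] conjI bexI[OF _ s] bexI[OF _ act_in[OF M d fM]] surj f_eq)
qed

lemma vertices_distinct_if_not_degenerate:
  assumes ns: "non_singular X" and f: "f \<in> simplices (mapping_sset X (std_simplex 1)) n"
    and nd: "\<not> degenerate (mapping_sset X (std_simplex 1)) n f"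
  shows "inj_on (\<lambda>a. act (mapping_sset X (std_simplex 1)) 0 n (vertex a) f) {..n}"
proof (rule linorder_inj_onI')
  let ?M = "mapping_sset X (std_simplex 1)"
  fix a b
  assume ab: "a \<in> {..n}" "b \<in> {..n}" "a < b"
  have f': "f \<in> simplicial_maps (prism n) X"
    using f by (simp add: mapping_sset_def)
  show "act ?M 0 n (vertex a) f \<noteq> act ?M 0 n (vertex b) f"
  proof
    assume eq: "act ?M 0 n (vertex a) f = act ?M 0 n (vertex b) f"
    have adjacent: "f 0 (vertex a, vertex \<epsilon>) = f 0 (vertex (Suc a), vertex \<epsilon>)" if "\<epsilon> \<le> 1" for \<epsilon>
    proof -
      \<comment> \<open>The simplex \<open>f(-, \<epsilon>)\<close> of \<open>X\<close>, whose vertices are the \<open>f(c, \<epsilon>)\<close>.\<close>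
      define x where "x = f n (id_operator n, \<lambda>i\<in>{..n}. \<epsilon>)"
      have c: "(\<lambda>i\<in>{..n}. \<epsilon>) \<in> operators n 1"
        using that by (intro operatorsI) auto
      have x: "x \<in> simplices X n"
        unfolding x_def by (rule prism_map_in[OF f' id_operator_in c])
      have v: "act X 0 n (vertex c) x = f 0 (vertex c, vertex \<epsilon>)" if "c \<le> n" for c
        unfolding x_def using prism_map_vertex[OF f' id_operator_in c that] that
        by (simp add: id_operator_def)
      have ev: "act ?M 0 n (vertex c) f 0 (id_operator 0, vertex \<epsilon>) = f 0 (vertex c, vertex \<epsilon>)"
        if "c \<le> n" for c
        using id_operator_in[of 0] vertex_in[OF \<open>\<epsilon> \<le> 1\<close>] compose_id_right[OF vertex_in[OF that]]
        by (simp add: mapping_sset_def prod_sset_def std_simplex_def)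
      have "f 0 (vertex a, vertex \<epsilon>) = f 0 (vertex b, vertex \<epsilon>)"
        using ev[of a] ev[of b] ab eq by simp
      then have "act X 0 n (vertex a) x = act X 0 n (vertex b) x"
        using v[of a] v[of b] ab by simp
      then have "act X 0 n (vertex a) x = act X 0 n (vertex (Suc a)) x"
        using ab by (intro vertex_eq_between[OF ns x, of a "Suc a" b]) auto
      then show ?thesis
        using v[of a] v[of "Suc a"] ab by simp
    qed
    have "a < n"
      using ab by simp
    then show False
      using degenerate_if_adjacent_vertices_eq[OF ns f' _ adjacent] nd by blast
  qed
qed

theorem proposition1p3:
  fixes X :: "'a sset"
  assumes "simplicial_set X"
    and "non_singular X"
  shows "non_singular (mapping_sset X (std_simplex 1))"
proof -
  let ?M = "mapping_sset X (std_simplex 1)"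
  have M: "simplicial_set ?M"
    using assms(1) simplicial_set_std_simplex by (rule simplicial_set_mapping)
  show ?thesis
    unfolding non_singular_def
  proof (intro conjI allI ballI impI M)
    fix n f
    assume "f \<in> simplices ?M n" "\<not> degenerate ?M n f"
    then show "degreewise_injective (std_simplex n) (representing_map ?M n f)"
      using vertices_distinct_if_not_degenerate[OF assms(2)]
      by (intro degreewise_injective_if_vertices_distinct[OF M])
  qed
qed

end
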